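(* Let $u(n,n)$ be the number of Hotelling protocols when each of the two players has $n$ strategy sets, let $\widehat u(n,n)=\Theta_n^2$, and let $Z=1/\log(1+\sqrt{\zeta})\approx 2.30322$ (all defined in the context). Then: a) $\widehat{u}(n,n)=(n!)^2\, Z^{2n}\, n^{O(1)}\approx (n!)^2\cdot 5.30482^n\cdot n^{O(1)}$; b) $u(n,n)=(n!)^2\, Z^{2n}\, n^{O(1)}\approx (n!)^2\cdot 5.30482^n\cdot n^{O(1)}$. Here $a(n)=b(n)\,n^{O(1)}$ means that there is a constant $C>0$ such that $n^{-C}\le a(n)/b(n)\le n^{C}$ for all $n\ge 2$, and $5.30482$ is the rounded numerical value of $Z^2$.
   Context: Simple protocols: for integers $i,j\ge 0$, a simple $(i,j)$-protocol is a finite string of symbols, each equal to $[A]$, $[B]$ or $[AB]$, in which no $[A]$ is immediately followed by $[A]$, no $[B]$ is immediately followed by $[B]$, the number of $[A]$'s plus the number of $[AB]$'s is $i$, and the number of $[B]$'s plus the number of $[AB]$'s is $j$. Let $t(i,j)$ be the number of simple $(i,j)$-protocols. Hotelling protocols: Alice has $m$ strategy sets (move types) and Bob has $n$. A Hotelling protocol is a finite sequence of turns, where at each turn a (possibly empty) set of Alice's move types and a (possibly empty) set of Bob's move types is prescribed, such that: each of Alice's $m$ types is used at exactly one turn and each of Bob's $n$ types is used at exactly one turn; at every turn at least one player makes at least one move; and there are no two consecutive turns at both of which Alice does not play, nor two consecutive turns at both of which Bob does not play. Let $u(m,n)$ be the number of Hotelling protocols. Writing ${m\brace i}$ for Stirling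 numbers of the second kind, the paper computes $$u(m,n)=\sum_{i\le m,\ j\le n} i!\,j!\,{m\brace i}{n\brace j}\,t(i,j).$$ Further notation: $\zeta\approx 0.295598$ is the real root of $y^3+y^2+3y-1$. $\Psi_m(i)=i!{m\brace i}\zeta^{-i/2}$, $\Theta_m=\sum_{i\le m}\Psi_m(i)$, and $$\widehat u(m,n)=\sum_{i\le m,\ j\le n} i!\,j!\,{m\brace i}{n\brace j}\,\zeta^{-(i+j)/2}=\Theta_m\Theta_n.$$ *)

theory Defs
  imports Complex_Main "HOL-Combinatorics.Stirling"
begin

text \<open>
  A Hotelling protocol is the list of its turns. The entry \<open>(A, B)\<close> says that the set \<open>A\<close> of
  Alice's move types and the set \<open>B\<close> of Bob's move types are prescribed at that turn. Alice's move
  types are the numbers below \<open>m\<close>, Bob's the numbers below \<open>n\<close>.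
\<close>

type_synonym protocol = "(nat set \<times> nat set) list"

definition hotelling_protocol :: "nat \<Rightarrow> nat \<Rightarrow> protocol \<Rightarrow> bool" where
  "hotelling_protocol m n p \<longleftrightarrow>
     (\<forall>(A, B) \<in> set p. A \<subseteq> {..<m} \<and> B \<subseteq> {..<n}) \<and>
     (\<forall>a<m. \<exists>!k. k < length p \<and> a \<in> fst (p ! k)) \<and>
     (\<forall>b<n. \<exists>!k. k < length p \<and> b \<in> snd (p ! k)) \<and>
     (\<forall>(A, B) \<in> set p. A \<noteq> {} \<or> B \<noteq> {}) \<and>
     (\<nexists>k. Suc k < length p \<and> fst (p ! k) = {} \<and> fst (p ! Suc k) = {}) \<and>
     (\<nexists>k. Suc k < length p \<and> snd (p ! k) = {} \<and> snd (p ! Suc k) = {})"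

definition u :: "nat \<Rightarrow> nat \<Rightarrow> nat" where
  "u m n = card {p. hotelling_protocol m n p}"

definition zeta :: real where
  "zeta = (THE y. y ^ 3 + y ^ 2 + 3 * y - 1 = 0)"

lemma zeta_ex1: "\<exists>!y::real. y ^ 3 + y ^ 2 + 3 * y - 1 = 0"
proof -
  have "\<exists>y\<ge>0. y \<le> 1 \<and> y ^ 3 + y ^ 2 + 3 * y - 1 = (0::real)"
    by (rule IVT') (auto intro!: continuous_intros)
  moreover have "y = z"
    if "y ^ 3 + y ^ 2 + 3 * y - 1 = 0" "z ^ 3 + z ^ 2 + 3 * z - 1 = 0" for y z :: real
  proof -
    have "(y - z) * (y ^ 2 + y * z + z ^ 2 + y + z + 3) = 0"
      using that by (simp add: algebra_simps power2_eq_square power3_eq_cube)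
    moreover have "y ^ 2 + y * z + z ^ 2 + y + z + 3
        = ((y + z) ^ 2 + (y + 1) ^ 2 + (z + 1) ^ 2) / 2 + 2"
      by (simp add: field_simps power2_eq_square)
    then have "y ^ 2 + y * z + z ^ 2 + y + z + 3 > 0"
      by (smt (verit) zero_le_power2 divide_nonneg_nonneg)
    ultimately show ?thesis by simp
  qed
  ultimately show ?thesis by blast
qed

definition Psi :: "nat \<Rightarrow> nat \<Rightarrow> real" where
  "Psi m i = fact i * real (Stirling m i) * zeta powr (- (real i / 2))"

definition Theta :: "nat \<Rightarrow> real" where
  "Theta m = (\<Sum>i\<le>m. Psi m i)"

definition u_hat :: "nat \<Rightarrow> nat \<Rightarrow> real" where
  "u_hat m n = (\<Sum>i\<le>m. \<Sum>j\<le>n. fact i * fact j * real (Stirling m i) * real (Stirling n j)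
                  * zeta powr (- ((real i + real j) / 2)))"

lemma u_hat_eq: "u_hat m n = Theta m * Theta n"
proof -
  have *: "zeta powr (- ((x + y) / 2)) = zeta powr (- (x / 2)) * zeta powr (- (y / 2))" for x y
    by (simp add: powr_add [symmetric] add_divide_distrib)
  show ?thesis
    unfolding u_hat_def Theta_def Psi_def sum_product *
    by (intro sum.cong refl) (simp only: mult_ac)
qed

definition Z :: real where
  "Z = 1 / ln (1 + sqrt zeta)"

text \<open>\<open>eq_upto_poly a b\<close> is the relation $a(n) = b(n)\, n^{O(1)}$.\<close>

definition eq_upto_poly :: "(nat \<Rightarrow> real) \<Rightarrow> (nat \<Rightarrow> real) \<Rightarrow> bool" where
  "eq_upto_poly a b \<longleftrightarrow>
     (\<exists>C>0. \<forall>n\<ge>2. real n powr (- C) \<le> a n / b n \<and> a n / b n \<le> real n powr C)"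

text \<open>
  \<open>rounds_to x q d\<close> is $x \approx q$ where \<open>q\<close> is given to \<open>d\<close> decimal places: \<open>q\<close> is the rounded
  value of \<open>x\<close>.
\<close>

definition rounds_to :: "real \<Rightarrow> real \<Rightarrow> nat \<Rightarrow> bool" where
  "rounds_to x q d \<longleftrightarrow> \<bar>x - q\<bar> < 1 / (2 * 10 ^ d)"

end

theory Submission
  imports
    Defs
    "HOL-Library.FuncSet"
    "HOL-Analysis.Harmonic_Numbers"
    "HOL-Analysis.Convex"
    "HOL-Computational_Algebra.Formal_Power_Series"
begin

text \<open>
  Write \<open>\<sigma> = sqrt \<zeta>\<close>; the cubic of \<open>\<zeta>\<close> becomes the tribonacci equation
  \<open>\<sigma>^3 + \<sigma>^2 + \<sigma> = 1\<close>. Put \<open>\<rho> = ln (1 + \<sigma>) = 1 / Z\<close>.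

  The exponential generating function of \<open>\<Theta>\<close> is \<open>1 / (1 - (exp z - 1) / \<sigma>)\<close>, so \<open>\<Theta>_n \<rho>^n / n!\<close>
  satisfies a renewal equation whose weights \<open>\<rho>^k / (\<sigma> k!)\<close>, \<open>k \<ge> 1\<close>, sum to 1. Hence it is at most 1,
  and as the tails of the weights are small it never drops below 1/2.

  The simple protocols with \<open>i + j = N\<close> are counted by a tribonacci sequence \<open>W_N\<close>, so
  \<open>\<sigma>^(-N) / 2 \<le> W_N \<le> 2 \<sigma>^(-N)\<close>. Trivially \<open>t(i,j) \<le> W_(i+j)\<close>, which bounds \<open>u\<close> above.
  Joining a protocol to the player-swapped copy of another one of the same type gives
  \<open>t(N+1,N+1) \<ge> (\<Sum>i. t(i,N-i)^2) \<ge> W_N^2 / (N+1)\<close>, and a second application of Cauchy-Schwarz to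
  the diagonal terms \<open>i = j\<close> of \<open>u(n,n)\<close> bounds \<open>u\<close> below.
\<close>

section \<open>Numerical value of the growth rate\<close>

definition sigma :: real where
  "sigma = sqrt zeta"

definition rho :: real where
  "rho = ln (1 + sigma)"

lemma zeta_root: "zeta ^ 3 + zeta\<^sup>2 + 3 * zeta - 1 = 0"
  unfolding zeta_def by (rule theI') (rule zeta_ex1)

lemma zeta_pos: "zeta > 0"
proof (rule ccontr)
  assume "\<not> zeta > 0"
  moreover have "zeta * (zeta\<^sup>2 + zeta + 3) = 1"
    using zeta_root by (simp add: algebra_simps power2_eq_square power3_eq_cube)
  moreover have "zeta\<^sup>2 + zeta + 3 = (zeta + 1/2)\<^sup>2 + 11/4"
    by (simp add: power2_eq_square field_simps)
  then have "zeta\<^sup>2 + zeta + 3 > 0"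
    by (smt (verit) zero_le_power2 divide_pos_pos)
  ultimately show False
    by (smt (verit) mult_nonneg_nonpos2 mult.commute)
qed

lemma sigma_pos: "sigma > 0"
  using zeta_pos by (simp add: sigma_def)

text \<open>With \<open>zeta\<close> replaced by the square of \<open>sigma\<close>, the cubic
  becomes a sextic that splits into two cubics in \<open>sigma\<close>; one of them is positive for
  \<open>sigma > 0\<close>, so the other vanishes.\<close>

lemma sigma_root: "sigma ^ 3 + sigma\<^sup>2 + sigma = 1"
proof -
  have z: "zeta = sigma\<^sup>2"
    using zeta_pos by (simp add: sigma_def)
  have "(sigma ^ 3 + sigma\<^sup>2 + sigma - 1) * (sigma ^ 3 - sigma\<^sup>2 + sigma + 1) = 0"
    using zeta_root unfolding z
    by (simp add: algebra_simps power2_eq_square power3_eq_cube)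
  moreover have "sigma ^ 3 - sigma\<^sup>2 + sigma + 1 = sigma * ((sigma - 1/2)\<^sup>2 + 3/4) + 1"
    by (simp add: algebra_simps power2_eq_square power3_eq_cube)
  then have "sigma ^ 3 - sigma\<^sup>2 + sigma + 1 > 0"
    using sigma_pos by (smt (verit) mult_nonneg_nonneg zero_le_power2 divide_pos_pos)
  ultimately show ?thesis by simp
qed

lemma sigma_bounds: "0.543689 < sigma" "sigma < 0.54368902"
proof -
  have mono: "x ^ 3 + x\<^sup>2 + x \<le> y ^ 3 + y\<^sup>2 + y" if "0 \<le> x" "x \<le> y" for x y :: real
    using that by (intro add_mono power_mono) auto
  show "0.543689 < sigma"
    using mono[of sigma "0.543689"] sigma_root sigma_pos
    by (cases "0.543689 < sigma") (auto simp: power2_eq_square power3_eq_cube)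
  show "sigma < 0.54368902"
    using mono[of "0.54368902" sigma] sigma_root
    by (cases "sigma < 0.54368902") (auto simp: power2_eq_square power3_eq_cube)
qed

text \<open>The bounds of \<open>ln_approx_bounds\<close> for \<open>ln x\<close> are partial sums
  in \<open>(x - 1) / (x + 1)\<close>. Parametrising \<open>x\<close> by this quantity
  \<open>y\<close> lets a short rational \<open>y\<close> be chosen, so that both bounds are
  evaluated exactly.\<close>

lemma ln_approx_bounds_moebius:
  fixes y :: real
  assumes "0 < y" "y < 1"
  shows "ln ((1 + y) / (1 - y)) \<in>
    {(\<Sum>k<n. 2 * y ^ (2*k+1) / real (2*k+1))..
     (\<Sum>k<n. 2 * y ^ (2*k+1) / real (2*k+1)) + 2 * (y ^ (2*n+1) / (1 - y\<^sup>2) / real (2*n+1))}"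
proof -
  have y: "((1 + y) / (1 - y) - 1) / ((1 + y) / (1 - y) + 1) = y"
    using assms by (simp add: divide_simps)
  have "(1 + y) / (1 - y) > 1" using assms by (simp add: field_simps)
  from ln_approx_bounds[OF this, of n, unfolded y] show ?thesis .
qed

lemma sum_lessThan_6: "(\<Sum>k<6. f k) = f 0 + f 1 + f 2 + f 3 + f 4 + (f (5::nat) :: real)"
  by (simp add: eval_nat_numeral)

lemma ln_lower_bound: "0.434175 < ln (1.543689 :: real)"
proof -
  \<comment> \<open>Slightly below \<open>0.543689 / 2.543689\<close>, so
    \<open>(1 + ?y) / (1 - ?y)\<close> stays below the argument of \<open>ln\<close>.\<close>
  let ?y = "213740358/10^9::real"
  have "0.434175 < (\<Sum>k<6. 2 * ?y ^ (2*k+1) / real (2*k+1))"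
    unfolding sum_lessThan_6 by (simp add: power_divide)
  also have "\<dots> \<le> ln ((1 + ?y) / (1 - ?y))"
    using ln_approx_bounds_moebius[of ?y 6] unfolding atLeastAtMost_iff by simp
  also have "\<dots> \<le> ln 1.543689"
    by (subst ln_le_cancel_iff) simp_all
  finally show ?thesis .
qed

lemma ln_upper_bound: "ln (1.54368902 :: real) < 0.43417505"
proof -
  \<comment> \<open>Slightly above \<open>0.54368902 / 2.54368902\<close>, for the opposite
    direction.\<close>
  let ?y = "213740366/10^9::real"
  have "ln 1.54368902 \<le> ln ((1 + ?y) / (1 - ?y))"
    by (subst ln_le_cancel_iff) simp_all
  also have "\<dots> \<le> (\<Sum>k<6. 2 * ?y ^ (2*k+1) / real (2*k+1)) + 2 * (?y ^ (2*6+1) / (1 - ?y\<^sup>2) / real (2*6+1))"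
    using ln_approx_bounds_moebius[of ?y 6] unfolding atLeastAtMost_iff by simp
  also have "\<dots> < 0.43417505"
    unfolding sum_lessThan_6 by (simp add: power_divide)
  finally show ?thesis .
qed

lemma rho_bounds: "0.434175 < rho" "rho < 0.43417505"
proof -
  have "ln 1.543689 \<le> rho" "rho \<le> ln 1.54368902"
    using sigma_bounds sigma_pos by (simp_all add: rho_def)
  then show "0.434175 < rho" "rho < 0.43417505"
    using ln_lower_bound ln_upper_bound by simp_all
qed

lemma Z_eq: "Z = 1 / rho"
  by (simp add: Z_def rho_def sigma_def)

lemma Z_bounds: "2.30321845 < Z" "Z < 2.303219"
  using rho_bounds by (simp_all add: Z_eq field_simps)

lemma rounds_to_Z: "rounds_to Z 2.30322 5"
  using Z_bounds by (simp add: rounds_to_def abs_less_iff)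

lemma rounds_to_Z_squared: "rounds_to (Z\<^sup>2) 5.30482 5"
proof -
  \<comment> \<open>The lower bound exceeds the rounding threshold 5.304815 by only about 2e-7;
    hence the narrow enclosures of \<open>sigma\<close> and \<open>rho\<close>.\<close>
  have "2.30321845\<^sup>2 < Z\<^sup>2" "Z\<^sup>2 < 2.303219\<^sup>2"
    using Z_bounds by (intro power_strict_mono; simp)+
  then show ?thesis
    by (simp add: rounds_to_def abs_less_iff power2_eq_square)
qed

section \<open>Growth of Theta\<close>

text \<open>The classical exponential generating function of surjection numbers. With
  \<open>e = exp - 1\<close>, the derivative of \<open>e ^ i\<close> is
  \<open>i * (e ^ (i - 1) + e ^ i)\<close>, which is the Stirling recurrence on
  coefficients.\<close>

lemma fps_exp_minus_one_power_nth:
  "fps_nth ((fps_exp 1 - 1) ^ i) n = fact i * real (Stirling n i) / fact n"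
proof (induction n arbitrary: i)
  case 0
  show ?case
    by (cases i) simp_all
next
  case (Suc n)
  show ?case
  proof (cases i)
    case 0
    then show ?thesis by simp
  next
    case (Suc k)
    let ?e = "fps_exp (1::real) - 1"
    have "real (Suc n) * fps_nth (?e ^ i) (Suc n) = fps_nth (fps_deriv (?e ^ i)) n"
      by simp
    also have "fps_deriv (?e ^ i) = of_nat i * (?e ^ k + ?e ^ i)"
    proof -
      have "fps_deriv (?e ^ Suc k) = of_nat (Suc k) * fps_exp 1 * ?e ^ k"
        by (subst fps_deriv_power') simp
      also have "\<dots> = of_nat (Suc k) * (?e ^ k + ?e ^ Suc k)"
        by (simp add: algebra_simps)
      finally show ?thesis
        by (simp only: Suc)
    qed
    also have "fps_nth \<dots> n = real i * (fps_nth (?e ^ k) n + fps_nth (?e ^ i) n)"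
      by (simp add: fps_of_nat[symmetric])
    also have "\<dots> = real (Suc n) * (fact i * real (Stirling (Suc n) i) / fact (Suc n))"
      unfolding Suc.IH Suc by (simp add: divide_simps) (simp add: algebra_simps)
    finally show ?thesis
      by (metis mult_left_cancel of_nat_neq_0)
  qed
qed

lemma Psi_eq: "Psi n i = fact i * real (Stirling n i) * (1 / sigma) ^ i"
proof -
  have "zeta powr (- (real i / 2)) = 1 / (zeta powr (1/2)) powr real i"
    by (simp add: powr_powr powr_minus_divide)
  also have "\<dots> = 1 / sigma ^ i"
    using zeta_pos sigma_pos by (simp add: powr_half_sqrt sigma_def powr_realpow)
  finally show ?thesis
    by (simp add: Psi_def power_one_over)
qed

text \<open>Stirling numbers vanish for \<open>i > n\<close>, so the range may be enlarged; the
  recurrence below needs one common range for all coefficients.\<close>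

lemma Theta_eq:
  assumes "n \<le> m"
  shows "Theta n / fact n = (\<Sum>i\<le>m. (1 / sigma) ^ i * fps_nth ((fps_exp 1 - 1) ^ i) n)"
proof -
  have "Theta n = (\<Sum>i\<le>m. Psi n i)"
    unfolding Theta_def using assms by (intro sum.mono_neutral_left) (auto simp: Psi_def)
  then show ?thesis
    by (simp add: Psi_eq fps_exp_minus_one_power_nth sum_divide_distrib mult_ac)
qed

text \<open>Coefficient form of \<open>G = 1 + G * (exp z - 1) / sigma\<close> for the generating
  function \<open>G\<close> of \<open>Theta\<close>: one factor is split off each positive power and
  the product is expanded as a convolution.\<close>

lemma Theta_rec:
  "Theta (Suc n) / fact (Suc n)
     = (\<Sum>k\<le>n. Theta k / fact k / (sigma * fact (Suc n - k)))"
proof -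
  let ?e = "fps_exp (1::real) - 1"
  have "Theta (Suc n) / fact (Suc n) = (\<Sum>i\<le>Suc n. (1 / sigma) ^ i * fps_nth (?e ^ i) (Suc n))"
    by (rule Theta_eq) simp
  also have "\<dots> = (\<Sum>i\<le>n. (1 / sigma) ^ Suc i * fps_nth (?e ^ Suc i) (Suc n))"
    by (subst sum.atMost_Suc_shift) simp
  also have "\<dots> = (\<Sum>i\<le>n. \<Sum>k\<le>n. (1 / sigma) ^ Suc i * (fps_nth (?e ^ i) k / fact (Suc n - k)))"
  proof (rule sum.cong[OF refl])
    fix i
    have "fps_nth (?e ^ Suc i) (Suc n) = fps_nth (?e ^ i * ?e) (Suc n)"
      by (simp add: mult.commute)
    \<comment> \<open>The term \<open>k = Suc n\<close> is absent because \<open>?e\<close> has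
      constant coefficient 0.\<close>
    also have "\<dots> = (\<Sum>k\<le>n. fps_nth (?e ^ i) k / fact (Suc n - k))"
      by (simp add: fps_mult_nth atLeast0AtMost Suc_diff_le)
    finally show "(1 / sigma) ^ Suc i * fps_nth (?e ^ Suc i) (Suc n)
        = (\<Sum>k\<le>n. (1 / sigma) ^ Suc i * (fps_nth (?e ^ i) k / fact (Suc n - k)))"
      by (simp add: sum_distrib_left)
  qed
  also have "\<dots> = (\<Sum>k\<le>n. \<Sum>i\<le>n. (1 / sigma) ^ Suc i * (fps_nth (?e ^ i) k / fact (Suc n - k)))"
    by (rule sum.swap)
  also have "\<dots> = (\<Sum>k\<le>n. Theta k / fact k / (sigma * fact (Suc n - k)))"
    by (intro sum.cong refl) (simp add: Theta_eq[of _ n] sum_divide_distrib mult_ac)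
  finally show ?thesis .
qed

section \<open>The renewal equation and two-sided bounds for its solution\<close>

definition scaled_Theta :: "nat \<Rightarrow> real" where
  "scaled_Theta n = Theta n * rho ^ n / fact n"

lemma scaled_Theta_0: "scaled_Theta 0 = 1"
  by (simp add: scaled_Theta_def Theta_def Psi_eq)

text \<open>Index \<open>j\<close> stands for a renewal step of length \<open>Suc j\<close>, so
  steps of length 0 do not occur and the weights form a series starting at 0.\<close>

definition renewal_weight :: "nat \<Rightarrow> real" where
  "renewal_weight j = rho ^ Suc j / (sigma * fact (Suc j))"

lemma renewal_weight_nonneg: "renewal_weight j \<ge> 0"
  using rho_bounds sigma_pos by (simp add: renewal_weight_def)

lemma scaled_Theta_Suc: "scaled_Theta (Suc n) = (\<Sum>k\<le>n. renewal_weight (n - k) * scaled_Theta k)"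
proof -
  have "scaled_Theta (Suc n) = rho ^ Suc n * (Theta (Suc n) / fact (Suc n))"
    by (simp add: scaled_Theta_def)
  also have "\<dots> = (\<Sum>k\<le>n. rho ^ Suc n * (Theta k / fact k / (sigma * fact (Suc n - k))))"
    by (subst Theta_rec) (simp add: sum_distrib_left)
  also have "\<dots> = (\<Sum>k\<le>n. renewal_weight (n - k) * scaled_Theta k)"
  proof (rule sum.cong[OF refl])
    fix k assume "k \<in> {..n}"
    then have "rho ^ Suc n = rho ^ Suc (n - k) * rho ^ k" "Suc n - k = Suc (n - k)"
      by (simp_all flip: power_add)
    then show "rho ^ Suc n * (Theta k / fact k / (sigma * fact (Suc n - k)))
        = renewal_weight (n - k) * scaled_Theta k"
      by (simp add: scaled_Theta_def renewal_weight_def mult_ac del: power_Suc fact_Suc)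
  qed
  finally show ?thesis .
qed

text \<open>The choice \<open>c = 1\<close> gives total mass 1; \<open>c = 2\<close> gives the
  exponential moment that controls the tails.\<close>

lemma renewal_weight_sums:
  "(\<lambda>j. renewal_weight j * c ^ Suc j) sums ((exp (c * rho) - 1) / sigma)"
proof -
  have "(\<lambda>j. (c * rho) ^ j / fact j) sums exp (c * rho)"
    using exp_converges[of "c * rho"] by (simp add: field_simps)
  then have "(\<lambda>j. (c * rho) ^ Suc j / fact (Suc j)) sums (exp (c * rho) - 1)"
    by (subst sums_Suc_iff) simp
  then have "(\<lambda>j. (c * rho) ^ Suc j / fact (Suc j) / sigma) sums ((exp (c * rho) - 1) / sigma)"
    by (rule sums_divide)
  then show ?thesis
    by (simp add: renewal_weight_def power_mult_distrib mult_ac)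
qed

lemma exp_rho: "exp rho = 1 + sigma"
  using sigma_pos by (simp add: rho_def)

lemma sum_atMost_rev: "(\<Sum>k\<le>m. f (m - k)) = (\<Sum>j\<le>m. f j)" for f :: "nat \<Rightarrow> real"
  using sum.nat_diff_reindex[of f "Suc m"] by (simp add: lessThan_Suc_atMost)

lemma scaled_Theta_upper: "scaled_Theta n \<le> 1"
proof (induction n rule: less_induct)
  case (less n)
  show ?case
  proof (cases n)
    case 0
    then show ?thesis by (simp add: scaled_Theta_0)
  next
    case (Suc m)
    have "scaled_Theta n \<le> (\<Sum>k\<le>m. renewal_weight (m - k))"
      unfolding Suc scaled_Theta_Suc using less[of _] Suc renewal_weight_nonneg
      by (intro sum_mono mult_left_le) auto
    also have "\<dots> = (\<Sum>j\<le>m. renewal_weight j)"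
      by (rule sum_atMost_rev)
    also have "\<dots> \<le> (exp (1 * rho) - 1) / sigma"
      using renewal_weight_sums[of 1] renewal_weight_nonneg
      by (metis (no_types, lifting) finite_atMost power_one mult.right_neutral sums_iff sum_le_suminf ext)
    also have "\<dots> = 1"
      using sigma_pos by (simp add: exp_rho)
    finally show ?thesis .
  qed
qed

text \<open>
  The weights sum to 1, so the constant bound would only lose the tail of the series at each step;
  the extra term \<open>(1/2) ^ n\<close> pays for that tail.
\<close>

lemma scaled_Theta_lower: "(1 + (1/2) ^ n) / 2 \<le> scaled_Theta n"
proof (induction n rule: less_induct)
  case (less n)
  show ?case
  proof (cases n)
    case 0
    then show ?thesis by (simp add: scaled_Theta_0)
  next
    case (Suc m)
    let ?p = renewal_weight
    let ?P = "\<Sum>j\<le>m. ?p j" and ?Q = "\<Sum>j\<le>m. ?p j * 2 ^ Suc j"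
    let ?tl = "\<Sum>j. ?p (j + Suc m)" and ?tl2 = "\<Sum>j. ?p (j + Suc m) * 2 ^ Suc (j + Suc m)"
    have s1: "?p sums 1"
      using renewal_weight_sums[of 1] sigma_pos by (simp add: exp_rho)
    have s2: "(\<lambda>j. ?p j * 2 ^ Suc j) sums (2 + sigma)"
    proof -
      have "(exp (2 * rho) - 1) / sigma = ((1 + sigma)\<^sup>2 - 1) / sigma"
        by (simp only: exp_double exp_rho)
      also have "\<dots> = 2 + sigma"
        using sigma_pos by (simp add: power2_eq_square field_simps)
      finally have "(exp (2 * rho) - 1) / sigma = 2 + sigma" .
      then show ?thesis
        using renewal_weight_sums[of 2] by simp
    qed
    have tl: "?P + ?tl = 1"
      using suminf_split_initial_segment[OF sums_summable[OF s1], of "Suc m"] sums_unique[OF s1]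
      by (simp add: lessThan_Suc_atMost)
    have tl2: "?Q + ?tl2 = 2 + sigma"
      using suminf_split_initial_segment[OF sums_summable[OF s2], of "Suc m"] sums_unique[OF s2]
      by (simp add: lessThan_Suc_atMost)
    \<comment> \<open>A Markov-type estimate: every term of the tail carries a factor of at least
      \<open>2 ^ Suc n\<close> in \<open>?tl2\<close>.\<close>
    have "2 * 2 ^ n * ?tl = (\<Sum>j. 2 * 2 ^ n * ?p (j + Suc m))"
      by (intro suminf_mult[symmetric] summable_ignore_initial_segment sums_summable[OF s1])
    also have "\<dots> \<le> ?tl2"
    proof (intro suminf_le summable_mult summable_ignore_initial_segment[OF sums_summable[OF s1]]
        summable_ignore_initial_segment[OF sums_summable[OF s2]])
      fix j
      have "(2::real) ^ Suc n \<le> 2 ^ Suc (j + Suc m)"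
        using Suc by (intro power_increasing) auto
      then have "?p (j + Suc m) * 2 ^ Suc n \<le> ?p (j + Suc m) * 2 ^ Suc (j + Suc m)"
        by (rule mult_left_mono[OF _ renewal_weight_nonneg])
      then show "2 * 2 ^ n * ?p (j + Suc m) \<le> ?p (j + Suc m) * 2 ^ Suc (j + Suc m)"
        by (simp only: power_Suc mult_ac)
    qed
    finally have tail: "2 * 2 ^ n * ?tl \<le> ?tl2" .
    \<comment> \<open>The first term of \<open>?Q\<close>, about 1.597, already exceeds the required
      \<open>(4 + sigma) / 3\<close>, about 1.515.\<close>
    have "2 * rho / sigma = ?p 0 * 2 ^ Suc 0"
      by (simp add: renewal_weight_def)
    also have "\<dots> \<le> ?Q"
      using renewal_weight_nonneg by (intro member_le_sum) auto
    finally have "2 * rho / sigma \<le> ?Q" .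
    moreover have "2 + sigma / 2 \<le> 3 * rho / sigma"
    proof -
      have "(2 + sigma / 2) * sigma \<le> (2 + 0.55 / 2) * 0.55"
        using sigma_bounds sigma_pos by (intro mult_mono) auto
      also have "\<dots> \<le> 3 * rho"
        using rho_bounds by simp
      finally show ?thesis
        using sigma_pos by (simp add: pos_le_divide_eq)
    qed
    ultimately have "2 + sigma / 2 \<le> 3 / 2 * ?Q"
      by simp
    then have "?tl2 / 2 \<le> ?Q - 1"
      using tl2 by simp
    then have "2 ^ n * ?tl \<le> ?Q - 1"
      using tail by linarith
    \<comment> \<open>The mass missing from \<open>?P\<close> is covered by the surplus of
      \<open>?Q\<close> over 1 in the geometric term.\<close>
    then have key: "?tl \<le> (?Q - 1) * (1/2) ^ n"
      by (simp add: power_one_over field_simps)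
    have "(1 + (1/2) ^ n) / 2 \<le> (?P + ?Q * (1/2) ^ n) / 2"
      using key tl by (simp add: algebra_simps)
    also have "\<dots> = (\<Sum>j\<le>m. ?p j * ((1 + (1/2) ^ (m - j)) / 2))"
    proof -
      have "?p j * ((1 + (1/2) ^ (m - j)) / 2) = (?p j + ?p j * 2 ^ Suc j * (1/2) ^ n) / 2"
        if "j \<in> {..m}" for j
      proof -
        have "(1/2::real) ^ n = (1/2) ^ Suc j * (1/2) ^ (m - j)"
          using that Suc by (simp flip: power_add)
        then show ?thesis
          by (simp add: power_one_over field_simps)
      qed
      then show ?thesis
        by (simp add: sum.distrib sum_distrib_right flip: sum_divide_distrib)
    qed
    also have "\<dots> = (\<Sum>k\<le>m. ?p (m - k) * ((1 + (1/2) ^ k) / 2))"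
      by (subst sum_atMost_rev[symmetric]) simp
    also have "\<dots> \<le> scaled_Theta n"
      unfolding Suc scaled_Theta_Suc using less Suc renewal_weight_nonneg
      by (intro sum_mono mult_left_mono) auto
    finally show ?thesis .
  qed
qed

section \<open>Protocols as words with two surjections\<close>

text \<open>Extensionality makes a function determined by its values on \<open>A\<close>, so that
  cardinalities are meaningful.\<close>

definition surjections :: "'a set \<Rightarrow> 'b set \<Rightarrow> ('a \<Rightarrow> 'b) set" where
  "surjections A B = {f \<in> A \<rightarrow>\<^sub>E B. f ` A = B}"

lemma finite_surjections: "finite A \<Longrightarrow> finite B \<Longrightarrow> finite (surjections A B)"
  by (rule finite_subset[of _ "A \<rightarrow>\<^sub>E B"]) (auto simp: surjections_def intro: finite_PiE)

text \<open>Once \<open>a\<close> is removed, its value \<open>b\<close> is either still attained on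
  \<open>A\<close> or missed there: the two cases of the Stirling recurrence.\<close>

lemma surjections_insert:
  assumes "a \<notin> A"
  shows "bij_betw (\<lambda>(b, f). f(a := b))
           (SIGMA b:B. surjections A B \<union> surjections A (B - {b})) (surjections (insert a A) B)"
proof (rule bij_betw_byWitness[where f' = "\<lambda>f. (f a, f(a := undefined))"])
  show "\<forall>x\<in>SIGMA b:B. surjections A B \<union> surjections A (B - {b}).
          (\<lambda>f. (f a, f(a := undefined))) ((\<lambda>(b, f). f(a := b)) x) = x"
    using assms by (auto simp: surjections_def fun_eq_iff PiE_def extensional_def)
  show "\<forall>f\<in>surjections (insert a A) B. (\<lambda>(b, f). f(a := b)) (f a, f(a := undefined)) = f"
    by auto
  show "(\<lambda>(b, f). f(a := b)) ` (SIGMA b:B. surjections A B \<union> surjections A (B - {b}))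
          \<subseteq> surjections (insert a A) B"
  proof clarify
    fix b f assume "b \<in> B" "f \<in> surjections A B \<union> surjections A (B - {b})"
    moreover have "(f(a := b)) ` A = f ` A"
      using assms by (auto simp: image_def)
    ultimately show "f(a := b) \<in> surjections (insert a A) B"
      by (auto simp: surjections_def PiE_def extensional_def Pi_def)
  qed
  show "(\<lambda>f. (f a, f(a := undefined))) ` surjections (insert a A) B
          \<subseteq> (SIGMA b:B. surjections A B \<union> surjections A (B - {b}))"
  proof (rule image_subsetI)
    fix f assume f: "f \<in> surjections (insert a A) B"
    have im: "(f(a := undefined)) ` A = f ` A"
      using assms by (auto simp: image_def)
    have B: "B = insert (f a) (f ` A)" and ext: "f(a := undefined) \<in> extensional A"
      using f by (auto simp: surjections_def PiE_def extensional_def)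
    have "f ` A = B \<or> f ` A = B - {f a}"
      using B by (cases "f a \<in> f ` A") auto
    moreover have PiE: "f(a := undefined) \<in> A \<rightarrow>\<^sub>E f ` A"
      using im ext assms by (auto simp: PiE_def)
    moreover from PiE have "f(a := undefined) \<in> surjections A (f ` A)"
      using im by (simp add: surjections_def del: fun_upd_apply)
    ultimately have "f(a := undefined) \<in> surjections A B \<union> surjections A (B - {f a})"
      by (metis UnI1 UnI2)
    then show "(f a, f(a := undefined)) \<in> (SIGMA b:B. surjections A B \<union> surjections A (B - {b}))"
      using B by blast
  qed
qed

lemma card_surjections:
  assumes "finite A" "finite B"
  shows "card (surjections A B) = fact (card B) * Stirling (card A) (card B)"
  using assms
proof (induction A arbitrary: B rule: finite_induct)
  case empty
  have "surjections ({} :: 'a set) B = (if B = {} then {\<lambda>_. undefined} else {})"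
    by (auto simp: surjections_def)
  with empty show ?case
    by (cases "card B") auto
next
  case (insert a A)
  show ?case
  proof (cases "card B")
    \<comment> \<open>A nonempty domain has no map to the empty set, matching
      \<open>Stirling (Suc _) 0 = 0\<close>.\<close>
    case 0
    then have "B = {}"
      using insert.prems by simp
    then show ?thesis
      using insert.hyps by (simp add: surjections_def)
  next
    case (Suc k)
    have "card (surjections (insert a A) B)
        = card (SIGMA b:B. surjections A B \<union> surjections A (B - {b}))"
      by (rule bij_betw_same_card[OF surjections_insert[OF insert.hyps(2)], symmetric])
    also have "\<dots> = (\<Sum>b\<in>B. card (surjections A B \<union> surjections A (B - {b})))"
      using insert by (simp add: card_SigmaI finite_surjections)
    also have "\<dots> = (\<Sum>b\<in>B. fact (Suc k) * Stirling (card A) (Suc k) + fact k * Stirling (card A) k)"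
    proof (rule sum.cong[OF refl])
      fix b assume "b \<in> B"
      moreover have "surjections A B \<inter> surjections A (B - {b}) = {}"
        using \<open>b \<in> B\<close> by (auto simp: surjections_def)
      ultimately show "card (surjections A B \<union> surjections A (B - {b}))
          = fact (Suc k) * Stirling (card A) (Suc k) + fact k * Stirling (card A) k"
        using insert Suc by (simp add: card_Un_disjoint finite_surjections)
    qed
    also have "\<dots> = fact (card B) * Stirling (card (insert a A)) (card B)"
      using Suc insert.hyps by (simp add: algebra_simps)
    finally show ?thesis .
  qed
qed

section \<open>Simple protocols as words\<close>

type_synonym word = "(bool \<times> bool) list"

text \<open>
  The symbols \<open>[A]\<close>, \<open>[B]\<close>, \<open>[AB]\<close> of a simple protocol are \<open>(True, False)\<close>, \<open>(False, True)\<close>,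
  \<open>(True, True)\<close>: the components record whether Alice, respectively Bob, plays.
\<close>

definition simple_word :: "word \<Rightarrow> bool" where
  "simple_word w \<longleftrightarrow> (\<forall>x\<in>set w. fst x \<or> snd x) \<and>
     successively (\<lambda>x y. (fst x \<or> fst y) \<and> (snd x \<or> snd y)) w"

definition plays_A :: "word \<Rightarrow> nat" where
  "plays_A w = length (filter fst w)"

definition plays_B :: "word \<Rightarrow> nat" where
  "plays_B w = length (filter snd w)"

text \<open>Its cardinality is the number t(i,j). Empty symbols being excluded, two neighbours
  without Bob are exactly [A][A], and two without Alice exactly [B][B].\<close>

definition simple_words :: "nat \<Rightarrow> nat \<Rightarrow> word set" where
  "simple_words i j = {w. simple_word w \<and> plays_A w = i \<and> plays_B w = j}"

definition turns_A :: "word \<Rightarrow> nat set" where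
  "turns_A w = {k. k < length w \<and> fst (w ! k)}"

definition turns_B :: "word \<Rightarrow> nat set" where
  "turns_B w = {k. k < length w \<and> snd (w ! k)}"

lemma card_turns [simp]: "card (turns_A w) = plays_A w" "card (turns_B w) = plays_B w"
  by (simp_all add: turns_A_def turns_B_def plays_A_def plays_B_def length_filter_conv_card)

lemma finite_turns [simp]: "finite (turns_A w)" "finite (turns_B w)"
  by (simp_all add: turns_A_def turns_B_def)

lemma length_le_plays: "(\<forall>x\<in>set w. fst x \<or> snd x) \<Longrightarrow> length w \<le> plays_A w + plays_B w"
  by (induction w) (auto simp: plays_A_def plays_B_def)

lemma finite_simple_words: "finite (simple_words i j)"
proof (rule finite_subset)
  show "simple_words i j \<subseteq> {w. set w \<subseteq> UNIV \<and> length w \<le> i + j}"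
    using length_le_plays by (auto simp: simple_words_def simple_word_def)
qed (rule finite_lists_length_le, simp)

text \<open>The maps \<open>f\<close> and \<open>g\<close> send each move type to its turn; a turn
  prescribes the fibres over its index.\<close>

definition protocol_of :: "nat \<Rightarrow> nat \<Rightarrow> word \<Rightarrow> (nat \<Rightarrow> nat) \<Rightarrow> (nat \<Rightarrow> nat) \<Rightarrow> protocol" where
  "protocol_of m n w f g = map (\<lambda>k. ({a. a < m \<and> f a = k}, {b. b < n \<and> g b = k})) [0..<length w]"

definition shape :: "protocol \<Rightarrow> word" where
  "shape p = map (\<lambda>(A, B). (A \<noteq> {}, B \<noteq> {})) p"

definition turn_of :: "nat \<Rightarrow> (nat \<Rightarrow> nat set) \<Rightarrow> nat \<Rightarrow> nat \<Rightarrow> nat" where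
  "turn_of l S m = (\<lambda>a\<in>{..<m}. THE k. k < l \<and> a \<in> S k)"

lemma successively_conv_nth:
  "successively P xs \<longleftrightarrow> (\<forall>k. Suc k < length xs \<longrightarrow> P (xs ! k) (xs ! Suc k))"
proof (induction P xs rule: successively.induct)
  case (3 P x y xs)
  show ?case
    by (subst successively.simps, subst 3) (auto simp: nth_Cons split: nat.splits)
qed auto

lemma hotelling_protocol_shape:
  assumes "hotelling_protocol m n p"
  shows "simple_word (shape p)"
  unfolding simple_word_def successively_conv_nth
proof (intro conjI ballI allI impI)
  fix x assume "x \<in> set (shape p)"
  then show "fst x \<or> snd x"
    using assms by (fastforce simp: shape_def hotelling_protocol_def)
next
  fix k assume "Suc k < length (shape p)"
  then show "fst (shape p ! k) \<or> fst (shape p ! Suc k)" "snd (shape p ! k) \<or> snd (shape p ! Suc k)"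
    using assms by (auto simp: shape_def hotelling_protocol_def case_prod_beta)
qed

text \<open>Sets that cover each \<open>a\<close> exactly once are the fibres of a unique map, whose
  image consists of the indices of nonempty sets. Stated for one family so as to serve both
  players.\<close>

lemma turn_of_surjection:
  assumes "\<forall>a<m. \<exists>!k. k < l \<and> a \<in> S k" "\<forall>k<l. S k \<subseteq> {..<m}"
  shows "turn_of l S m \<in> surjections {..<m} {k. k < l \<and> S k \<noteq> {}}"
    and "\<And>k. k < l \<Longrightarrow> {a. a < m \<and> turn_of l S m a = k} = S k"
proof -
  have ex: "turn_of l S m a < l \<and> a \<in> S (turn_of l S m a)" if "a < m" for a
    using theI'[of "\<lambda>k. k < l \<and> a \<in> S k"] assms(1) that by (simp add: turn_of_def)
  have eq: "turn_of l S m a = k" if "k < l" "a \<in> S k" for a k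
  proof -
    have "a < m"
      using assms(2) that by blast
    then show ?thesis
      using assms(1) that ex by blast
  qed
  have "turn_of l S m ` {..<m} = {k. k < l \<and> S k \<noteq> {}}"
  proof (intro equalityI subsetI)
    fix k assume "k \<in> turn_of l S m ` {..<m}"
    then show "k \<in> {k. k < l \<and> S k \<noteq> {}}"
      using ex by auto
  next
    fix k assume "k \<in> {k. k < l \<and> S k \<noteq> {}}"
    then obtain a where "k < l" "a \<in> S k"
      by auto
    moreover from this have "a < m"
      using assms(2) by blast
    ultimately show "k \<in> turn_of l S m ` {..<m}"
      using eq by (intro image_eqI[of _ _ a]) auto
  qed
  then show "turn_of l S m \<in> surjections {..<m} {k. k < l \<and> S k \<noteq> {}}"
    by (auto simp: surjections_def turn_of_def)
  show "{a. a < m \<and> turn_of l S m a = k} = S k" if "k < l" for k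
    using ex eq[OF that] assms(2) that by blast
qed

lemma surjections_fibre_nonempty:
  assumes "f \<in> surjections {..<m} T"
  shows "{a. a < m \<and> f a = k} \<noteq> {} \<longleftrightarrow> k \<in> T"
  using assms by (auto simp: surjections_def)

text \<open>Surjectivity makes the fibre nonempty at exactly the turns where the player is active,
  so the word can be read off the protocol.\<close>

lemma shape_protocol_of:
  assumes "f \<in> surjections {..<m} (turns_A w)" "g \<in> surjections {..<n} (turns_B w)"
  shows "shape (protocol_of m n w f g) = w"
proof (rule nth_equalityI)
  fix k assume "k < length (shape (protocol_of m n w f g))"
  then have k: "k < length w"
    by (simp add: shape_def protocol_of_def)
  then have "shape (protocol_of m n w f g) ! k = (k \<in> turns_A w, k \<in> turns_B w)"
    using surjections_fibre_nonempty[OF assms(1)] surjections_fibre_nonempty[OF assms(2)]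
    by (simp add: shape_def protocol_of_def)
  then show "shape (protocol_of m n w f g) ! k = w ! k"
    using k by (simp add: turns_A_def turns_B_def)
qed (simp add: shape_def protocol_of_def)

lemma hotelling_protocol_of:
  assumes w: "simple_word w"
    and f: "f \<in> surjections {..<m} (turns_A w)" and g: "g \<in> surjections {..<n} (turns_B w)"
  shows "hotelling_protocol m n (protocol_of m n w f g)"
proof -
  let ?p = "protocol_of m n w f g"
  have len: "length ?p = length w"
    by (simp add: protocol_of_def)
  have nth: "?p ! k = ({a. a < m \<and> f a = k}, {b. b < n \<and> g b = k})" if "k < length w" for k
    using that by (simp add: protocol_of_def)
  have ne: "fst (?p ! k) \<noteq> {} \<longleftrightarrow> fst (w ! k)" "snd (?p ! k) \<noteq> {} \<longleftrightarrow> snd (w ! k)"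
    if "k < length w" for k
    using surjections_fibre_nonempty[OF f] surjections_fibre_nonempty[OF g] that
    by (simp_all add: nth turns_A_def turns_B_def)
  have lt: "f a < length w" if "a < m" for a
    using f that by (auto simp: surjections_def turns_A_def)
  have lt': "g b < length w" if "b < n" for b
    using g that by (auto simp: surjections_def turns_B_def)
  have succ: "(fst (w ! k) \<or> fst (w ! Suc k)) \<and> (snd (w ! k) \<or> snd (w ! Suc k))"
    if "Suc k < length w" for k
    using w that by (simp add: simple_word_def successively_conv_nth)
  show ?thesis
    unfolding hotelling_protocol_def
  proof (intro conjI)
    show "\<forall>(A, B)\<in>set ?p. A \<subseteq> {..<m} \<and> B \<subseteq> {..<n}"
      by (auto simp: protocol_of_def)
    show "\<forall>a<m. \<exists>!k. k < length ?p \<and> a \<in> fst (?p ! k)"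
      using lt by (auto simp: len nth intro!: ex1I)
    show "\<forall>b<n. \<exists>!k. k < length ?p \<and> b \<in> snd (?p ! k)"
      using lt' by (auto simp: len nth intro!: ex1I)
    show "\<forall>(A, B)\<in>set ?p. A \<noteq> {} \<or> B \<noteq> {}"
    proof
      fix x assume "x \<in> set ?p"
      then obtain k where k: "k < length w" "?p ! k = x"
        using len by (metis in_set_conv_nth)
      moreover have "fst (w ! k) \<or> snd (w ! k)"
        using w k nth_mem unfolding simple_word_def by blast
      ultimately show "case x of (A, B) \<Rightarrow> A \<noteq> {} \<or> B \<noteq> {}"
        using ne[of k] by (auto simp: case_prod_beta)
    qed
    show "\<nexists>k. Suc k < length ?p \<and> fst (?p ! k) = {} \<and> fst (?p ! Suc k) = {}"
         "\<nexists>k. Suc k < length ?p \<and> snd (?p ! k) = {} \<and> snd (?p ! Suc k) = {}"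
      using ne succ len by (metis Suc_lessD)+
  qed
qed

text \<open>A surjection from \<open>m\<close> move types reaches at most \<open>m\<close> turns, so
  other words contribute nothing; the bounds make the set finite.\<close>

definition bounded_words :: "nat \<Rightarrow> nat \<Rightarrow> word set" where
  "bounded_words m n = {w. simple_word w \<and> plays_A w \<le> m \<and> plays_B w \<le> n}"

lemma bounded_words_eq: "bounded_words m n = (\<Union>(i, j)\<in>{..m} \<times> {..n}. simple_words i j)"
  by (auto simp: bounded_words_def simple_words_def)

lemma surjections_card_le:
  assumes "f \<in> surjections {..<m} T"
  shows "card T \<le> m"
  using assms card_image_le[of "{..<m}" f] by (auto simp: surjections_def)

text \<open>Injectivity: \<open>shape\<close> returns the word, and the fibres return the two maps.
  Surjectivity: \<open>shape\<close> and \<open>turn_of\<close> supply a preimage.\<close>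

lemma bij_betw_protocol_of:
  "bij_betw (\<lambda>(w, f, g). protocol_of m n w f g)
     (SIGMA w:bounded_words m n. surjections {..<m} (turns_A w) \<times> surjections {..<n} (turns_B w))
     {p. hotelling_protocol m n p}"
  unfolding bij_betw_def
proof (intro conjI)
  show "inj_on (\<lambda>(w, f, g). protocol_of m n w f g)
     (SIGMA w:bounded_words m n. surjections {..<m} (turns_A w) \<times> surjections {..<n} (turns_B w))"
    (is "inj_on ?F ?X")
  proof (rule inj_onI)
    fix x y assume xy: "x \<in> ?X" "y \<in> ?X" "?F x = ?F y"
    obtain w f g w' f' g' where xy_eq: "x = (w, f, g)" "y = (w', f', g')"
      using prod_cases3 by metis
    have S: "f \<in> surjections {..<m} (turns_A w)" "g \<in> surjections {..<n} (turns_B w)"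
      "f' \<in> surjections {..<m} (turns_A w')" "g' \<in> surjections {..<n} (turns_B w')"
      and eq: "protocol_of m n w f g = protocol_of m n w' f' g'"
      using xy by (simp_all add: xy_eq)
    have w: "w' = w"
      using shape_protocol_of[OF S(1,2)] shape_protocol_of[OF S(3,4)] eq by simp
    have fib: "{a. a < m \<and> f a = k} = {a. a < m \<and> f' a = k}"
      "{b. b < n \<and> g b = k} = {b. b < n \<and> g' b = k}" if "k < length w" for k
      using arg_cong[OF eq, of "\<lambda>p. p ! k"] that by (simp_all add: protocol_of_def w)
    have "f = f'"
    proof (rule extensionalityI)
      fix a assume a: "a \<in> {..<m}"
      then have "f a < length w"
        using S(1) by (auto simp: surjections_def turns_A_def)
      from fib(1)[OF this] a have "a \<in> {a'. a' < m \<and> f' a' = f a}"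
        by blast
      then show "f a = f' a"
        by simp
    qed (use S in \<open>auto simp: surjections_def PiE_def\<close>)
    moreover have "g = g'"
    proof (rule extensionalityI)
      fix b assume b: "b \<in> {..<n}"
      then have "g b < length w"
        using S(2) by (auto simp: surjections_def turns_B_def)
      from fib(2)[OF this] b have "b \<in> {b'. b' < n \<and> g' b' = g b}"
        by blast
      then show "g b = g' b"
        by simp
    qed (use S in \<open>auto simp: surjections_def PiE_def\<close>)
    ultimately show "x = y"
      using w xy_eq by simp
  qed
  show "(\<lambda>(w, f, g). protocol_of m n w f g) `
     (SIGMA w:bounded_words m n. surjections {..<m} (turns_A w) \<times> surjections {..<n} (turns_B w))
     = {p. hotelling_protocol m n p}"
  proof (intro equalityI subsetI)
    fix p assume "p \<in> {p. hotelling_protocol m n p}"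
    then have p: "hotelling_protocol m n p"
      by simp
    define w f g where "w = shape p" and "f = turn_of (length p) (\<lambda>k. fst (p ! k)) m"
      and "g = turn_of (length p) (\<lambda>k. snd (p ! k)) n"
    have sub: "\<forall>k<length p. fst (p ! k) \<subseteq> {..<m}" "\<forall>k<length p. snd (p ! k) \<subseteq> {..<n}"
    proof -
      have "\<forall>x\<in>set p. fst x \<subseteq> {..<m} \<and> snd x \<subseteq> {..<n}"
        using p by (simp add: hotelling_protocol_def case_prod_beta)
      then show "\<forall>k<length p. fst (p ! k) \<subseteq> {..<m}" "\<forall>k<length p. snd (p ! k) \<subseteq> {..<n}"
        using nth_mem by blast+
    qed
    have ex: "\<forall>a<m. \<exists>!k. k < length p \<and> a \<in> fst (p ! k)"
      "\<forall>b<n. \<exists>!k. k < length p \<and> b \<in> snd (p ! k)"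
      using p unfolding hotelling_protocol_def by - (elim conjE, assumption)+
    have turns: "turns_A w = {k. k < length p \<and> fst (p ! k) \<noteq> {}}"
      "turns_B w = {k. k < length p \<and> snd (p ! k) \<noteq> {}}"
      by (auto simp: turns_A_def turns_B_def w_def shape_def case_prod_beta)
    have fg: "f \<in> surjections {..<m} (turns_A w)" "g \<in> surjections {..<n} (turns_B w)"
      unfolding turns f_def g_def
      using turn_of_surjection(1)[OF ex(1) sub(1)] turn_of_surjection(1)[OF ex(2) sub(2)] .
    then have "w \<in> bounded_words m n"
      using surjections_card_le[OF fg(1)] surjections_card_le[OF fg(2)] hotelling_protocol_shape[OF p]
      by (simp add: bounded_words_def w_def)
    moreover have "p = protocol_of m n w f g"
    proof (rule nth_equalityI)
      show "length p = length (protocol_of m n w f g)"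
        by (simp add: protocol_of_def w_def shape_def)
      fix k assume "k < length p"
      then show "p ! k = protocol_of m n w f g ! k"
        using turn_of_surjection(2)[OF ex(1) sub(1)] turn_of_surjection(2)[OF ex(2) sub(2)]
        by (simp add: protocol_of_def w_def shape_def f_def g_def)
    qed
    ultimately show "p \<in> (\<lambda>(w, f, g). protocol_of m n w f g) `
      (SIGMA w:bounded_words m n. surjections {..<m} (turns_A w) \<times> surjections {..<n} (turns_B w))"
      using fg by (intro image_eqI[of _ _ "(w, f, g)"]) simp_all
  qed (auto simp: bounded_words_def intro!: hotelling_protocol_of)
qed

lemma simple_words_disjoint:
  "i \<noteq> i' \<or> j \<noteq> j' \<Longrightarrow> simple_words i j \<inter> simple_words i' j' = {}"
  by (auto simp: simple_words_def)

text \<open>In the bijection above, the number of pairs of surjections depends only on the type of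
  the word, so words are grouped by type.\<close>

lemma u_eq:
  "u m n = (\<Sum>i\<le>m. \<Sum>j\<le>n. fact i * Stirling m i * (fact j * Stirling n j) * card (simple_words i j))"
proof -
  have fin: "finite (bounded_words m n)"
    by (auto simp: bounded_words_eq finite_simple_words)
  have "u m n = card (SIGMA w:bounded_words m n.
      surjections {..<m} (turns_A w) \<times> surjections {..<n} (turns_B w))"
    unfolding u_def using bij_betw_same_card[OF bij_betw_protocol_of] by simp
  also have "\<dots> = (\<Sum>w\<in>bounded_words m n.
      fact (plays_A w) * Stirling m (plays_A w) * (fact (plays_B w) * Stirling n (plays_B w)))"
    using fin by (simp add: card_SigmaI finite_surjections card_cartesian_product card_surjections)
  also have "\<dots> = (\<Sum>(i, j)\<in>{..m} \<times> {..n}. \<Sum>w\<in>simple_words i j.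
      fact (plays_A w) * Stirling m (plays_A w) * (fact (plays_B w) * Stirling n (plays_B w)))"
    unfolding bounded_words_eq
    by (subst sum.UNION_disjoint) (auto simp: finite_simple_words simple_words_disjoint intro!: sum.cong)
  also have "\<dots> = (\<Sum>(i, j)\<in>{..m} \<times> {..n}. \<Sum>w\<in>simple_words i j.
      fact i * Stirling m i * (fact j * Stirling n j))"
    by (intro sum.cong refl) (auto simp: simple_words_def)
  also have "\<dots> = (\<Sum>i\<le>m. \<Sum>j\<le>n. fact i * Stirling m i * (fact j * Stirling n j) * card (simple_words i j))"
    by (simp add: sum.cartesian_product mult_ac)
  finally show ?thesis .
qed

section \<open>Words of given cost\<close>

definition cost :: "word \<Rightarrow> nat" where
  "cost w = plays_A w + plays_B w"

definition words_of_cost :: "nat \<Rightarrow> word set" where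
  "words_of_cost N = {w. simple_word w \<and> cost w = N}"

text \<open>Among simple words these start with [A] or [B]; they are the auxiliary sequence of the
  tribonacci recurrence.\<close>

definition single_start :: "nat \<Rightarrow> word set" where
  "single_start N = {w \<in> words_of_cost N. w \<noteq> [] \<and> hd w \<noteq> (True, True)}"

lemma cost_simps [simp]:
  "cost [] = 0" "cost (x # w) = of_bool (fst x) + of_bool (snd x) + cost w"
  "cost (v @ w) = cost v + cost w"
  by (auto simp: cost_def plays_A_def plays_B_def)

lemma simple_word_Nil [simp]: "simple_word []"
  by (simp add: simple_word_def)

lemma simple_word_Cons_both: "simple_word ((True, True) # w) \<longleftrightarrow> simple_word w"
  by (cases w) (auto simp: simple_word_def successively_Cons)

lemma simple_word_Cons_single:
  assumes "x = (True, False) \<or> x = (False, True)"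
  shows "simple_word (x # w) \<longleftrightarrow> simple_word w \<and> (w = [] \<or> hd w \<noteq> x)"
  using assms by (cases w) (auto simp: simple_word_def)

lemma words_of_cost_eq: "words_of_cost N = (\<Union>i\<le>N. simple_words i (N - i))"
  by (auto simp: words_of_cost_def simple_words_def cost_def)

lemma finite_words_of_cost [simp]: "finite (words_of_cost N)"
  by (auto simp: words_of_cost_eq finite_simple_words)

lemma finite_single_start [simp]: "finite (single_start N)"
  by (simp add: single_start_def)

lemma card_words_of_cost: "card (words_of_cost N) = (\<Sum>i\<le>N. card (simple_words i (N - i)))"
  unfolding words_of_cost_eq
  by (rule card_UN_disjoint) (auto simp: finite_simple_words simple_words_disjoint)

lemma words_of_cost_0: "words_of_cost 0 = {[]}"
  using length_le_plays by (fastforce simp: words_of_cost_def cost_def simple_word_def plays_A_def plays_B_def)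

lemma card_words_of_cost_Suc_Suc:
  "card (words_of_cost (Suc (Suc N))) = card (single_start (Suc (Suc N))) + card (words_of_cost N)"
proof -
  have "words_of_cost (Suc (Suc N))
      = single_start (Suc (Suc N)) \<union> Cons (True, True) ` words_of_cost N"
  proof (intro equalityI subsetI)
    fix w assume w: "w \<in> words_of_cost (Suc (Suc N))"
    then obtain x v where wx: "w = x # v"
      by (cases w) (auto simp: words_of_cost_def)
    show "w \<in> single_start (Suc (Suc N)) \<union> Cons (True, True) ` words_of_cost N"
      using w by (cases "x = (True, True)")
        (auto simp: wx words_of_cost_def single_start_def simple_word_Cons_both)
  qed (auto simp: words_of_cost_def single_start_def simple_word_Cons_both)
  moreover have "single_start (Suc (Suc N)) \<inter> Cons (True, True) ` words_of_cost N = {}"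
    by (auto simp: single_start_def)
  ultimately show ?thesis
    by (simp add: card_Un_disjoint card_image)
qed

text \<open>Consider pairs of a letter [A] or [B] and a word of cost \<open>N\<close>. Either the
  letter may be prefixed, giving a word of cost \<open>Suc N\<close>, or it repeats the first letter
  and is determined by the word.\<close>

lemma card_single_start_Suc:
  "card (single_start (Suc N)) + card (single_start N) = 2 * card (words_of_cost N)"
proof -
  let ?L = "{(True, False), (False, True)}"
  let ?P = "?L \<times> words_of_cost N"
  let ?ok = "{(x, w) \<in> ?P. w = [] \<or> hd w \<noteq> x}" and ?bad = "{(x, w) \<in> ?P. w \<noteq> [] \<and> hd w = x}"
  have "bij_betw (\<lambda>(x, w). x # w) ?ok (single_start (Suc N))"
  proof (rule bij_betw_byWitness[where f' = "\<lambda>w. (hd w, tl w)"])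
    show "(\<lambda>(x, w). x # w) ` ?ok \<subseteq> single_start (Suc N)"
      by (auto simp: single_start_def words_of_cost_def simple_word_Cons_single)
    show "(\<lambda>w. (hd w, tl w)) ` single_start (Suc N) \<subseteq> ?ok"
    proof (rule image_subsetI)
      fix w assume w: "w \<in> single_start (Suc N)"
      then obtain x v where wx: "w = x # v"
        by (cases w) (auto simp: single_start_def)
      have x: "x = (True, False) \<or> x = (False, True)"
        using w by (cases x) (auto simp: wx single_start_def words_of_cost_def simple_word_def)
      show "(hd w, tl w) \<in> ?ok"
        using w x by (auto simp: wx single_start_def words_of_cost_def simple_word_Cons_single)
    qed
  qed (auto simp: single_start_def)
  moreover have "bij_betw snd ?bad (single_start N)"
  proof (rule bij_betw_byWitness[where f' = "\<lambda>w. (hd w, w)"])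
    show "(\<lambda>w. (hd w, w)) ` single_start N \<subseteq> ?bad"
    proof (rule image_subsetI)
      fix w assume w: "w \<in> single_start N"
      then have "hd w \<in> set w"
        by (auto simp: single_start_def)
      then have "fst (hd w) \<or> snd (hd w)"
        using w by (auto simp: single_start_def words_of_cost_def simple_word_def)
      then have "hd w \<in> ?L"
        using w by (cases "hd w") (auto simp: single_start_def)
      then show "(hd w, w) \<in> ?bad"
        using w by (simp add: single_start_def)
    qed
  qed (auto simp: single_start_def)
  moreover have "card ?P = card ?ok + card ?bad"
  proof -
    have "?P = ?ok \<union> ?bad" "?ok \<inter> ?bad = {}"
      by auto
    moreover have "finite ?P"
      by simp
    ultimately show ?thesis
      by (metis (no_types, lifting) card_Un_disjoint finite_Un)
  qed
  ultimately show ?thesis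
    by (simp add: bij_betw_same_card card_cartesian_product)
qed

text \<open>Write W for all words and D for those in \<open>single_start\<close>. Then W(N+3) =
  D(N+3) + W(N+1), D(N+3) + D(N+2) = 2 W(N+2) and D(N+2) = W(N+2) - W(N); eliminating D gives the
  claim.\<close>

lemma card_words_of_cost_rec:
  "card (words_of_cost (N + 3))
     = card (words_of_cost (N + 2)) + card (words_of_cost (N + 1)) + card (words_of_cost N)"
  using card_words_of_cost_Suc_Suc[of "Suc N"] card_words_of_cost_Suc_Suc[of N]
    card_single_start_Suc[of "Suc (Suc N)"]
  by (simp add: eval_nat_numeral)

lemma card_words_of_cost_init:
  "card (words_of_cost 0) = 1" "card (words_of_cost 1) = 2" "card (words_of_cost 2) = 3"
proof -
  show w0: "card (words_of_cost 0) = 1"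
    by (simp add: words_of_cost_0)
  have "single_start 0 = {}"
    by (auto simp: single_start_def words_of_cost_0)
  then have d1: "card (single_start 1) = 2"
    using card_single_start_Suc[of 0] w0 by simp
  \<comment> \<open>A word of cost 1 cannot start with [AB], which costs 2.\<close>
  have "w \<in> single_start 1" if "w \<in> words_of_cost 1" for w
    using that by (cases w) (auto simp: single_start_def words_of_cost_def)
  then have "words_of_cost 1 = single_start 1"
    by (auto simp: single_start_def)
  then show w1: "card (words_of_cost 1) = 2"
    using d1 by simp
  show "card (words_of_cost 2) = 3"
    using card_single_start_Suc[of 1] card_words_of_cost_Suc_Suc[of 0] w0 w1 d1
    by (simp add: eval_nat_numeral)
qed

section \<open>Balanced words\<close>

definition swap_word :: "word \<Rightarrow> word" where
  "swap_word w = map prod.swap w"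

lemma swap_word_simple_words: "swap_word w \<in> simple_words j i \<longleftrightarrow> w \<in> simple_words i j"
proof -
  have "simple_word (swap_word w) \<longleftrightarrow> simple_word w"
    by (simp add: simple_word_def swap_word_def successively_map conj_commute disj_commute)
  moreover have "plays_A (swap_word w) = plays_B w" "plays_B (swap_word w) = plays_A w"
    by (simp_all add: plays_A_def plays_B_def swap_word_def filter_map comp_def)
  ultimately show ?thesis
    by (auto simp: simple_words_def)
qed

text \<open>The symbol [AB] is compatible with every neighbour, so it decouples the two
  sides.\<close>

lemma simple_word_join:
  "simple_word (v @ (True, True) # w) \<longleftrightarrow> simple_word v \<and> simple_word w"
  by (cases w) (auto simp: simple_word_def successively_append_iff)

lemma cost_pos: "\<forall>x\<in>set w. fst x \<or> snd x \<Longrightarrow> cost w = 0 \<Longrightarrow> w = []"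
  by (cases w) auto

text \<open>One of two prefixes of the same list extends the other; equal cost forces the extension
  to be empty, since every symbol has positive cost.\<close>

lemma append_cost_inject:
  assumes "v @ w = v' @ w'" "cost v = cost v'" "simple_word v" "simple_word v'"
  shows "v = v' \<and> w = w'"
proof -
  from assms(1) obtain us where "v = v' @ us \<and> us @ w = w' \<or> v @ us = v' \<and> w = us @ w'"
    by (auto simp: append_eq_append_conv2)
  moreover from this have "us = []"
    using assms cost_pos[of us] by (auto simp: simple_word_def)
  ultimately show ?thesis
    by auto
qed

text \<open>
  Joining a word with the player-swapped copy of another word of the same type by a turn \<open>[AB]\<close>
  yields a balanced word; this avoids any analysis of which \<open>(i, j)\<close> dominates on an antidiagonal.
\<close>

lemma card_simple_words_diag:
  "(\<Sum>i\<le>N. (card (simple_words i (N - i)))\<^sup>2) \<le> card (simple_words (Suc N) (Suc N))"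
proof -
  let ?D = "SIGMA i:{..N}. simple_words i (N - i) \<times> simple_words i (N - i)"
  let ?f = "\<lambda>(i, v, w). v @ (True, True) # swap_word w"
  have "inj_on ?f ?D"
  proof (rule inj_onI)
    fix x y assume xy: "x \<in> ?D" "y \<in> ?D" "?f x = ?f y"
    obtain i v w i' v' w' where xy_eq: "x = (i, v, w)" "y = (i', v', w')"
      using prod_cases3 by metis
    have "v @ (True, True) # swap_word w = v' @ (True, True) # swap_word w'"
      "simple_word v" "simple_word v'" "cost v = N" "cost v' = N"
      "plays_A v = i" "plays_A v' = i'"
      using xy by (auto simp: xy_eq simple_words_def cost_def)
    then have "v = v'" "swap_word w = swap_word w'" "i = i'"
      using append_cost_inject[of v _ v'] by auto
    moreover from this have "w = w'"
      by (simp add: swap_word_def inj_map_eq_map)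
    ultimately show "x = y"
      using xy_eq by simp
  qed
  moreover have "?f ` ?D \<subseteq> simple_words (Suc N) (Suc N)"
  proof (rule image_subsetI)
    fix x assume x: "x \<in> ?D"
    obtain i v w where x_eq: "x = (i, v, w)"
      by (rule prod_cases3)
    have "i \<le> N" "v \<in> simple_words i (N - i)" "swap_word w \<in> simple_words (N - i) i"
      using x by (simp_all add: x_eq swap_word_simple_words)
    then show "?f x \<in> simple_words (Suc N) (Suc N)"
      \<comment> \<open>Alice plays \<open>i\<close> times in \<open>v\<close>, once at the joint
        and \<open>N - i\<close> times in the swapped copy; for Bob \<open>i\<close> and
        \<open>N - i\<close> are exchanged.\<close>
      by (simp add: x_eq simple_words_def simple_word_join) (simp add: plays_A_def plays_B_def)
  qed
  ultimately have "card ?D \<le> card (simple_words (Suc N) (Suc N))"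
    by (rule card_inj_on_le) (rule finite_simple_words)
  then show ?thesis
    by (simp add: card_SigmaI finite_simple_words card_cartesian_product power2_eq_square)
qed

lemma simple_words_0: "simple_words 0 0 = {[]}"
  using words_of_cost_0 by (auto simp: simple_words_def words_of_cost_def cost_def)

section \<open>Asymptotics\<close>

text \<open>Powers of \<open>1 / sigma\<close> obey the same tribonacci recurrence as the counts, so
  the factors 1/2 and 2 need checking only for the three initial values.\<close>

lemma words_of_cost_bounds:
  "(1 / sigma) ^ N / 2 \<le> card (words_of_cost N) \<and> card (words_of_cost N) \<le> 2 * (1 / sigma) ^ N"
proof (induction N rule: less_induct)
  case (less N)
  let ?x = "1 / sigma"
  have x: "1.8 \<le> ?x" "?x \<le> 1.9"
    using sigma_bounds by (simp_all add: field_simps)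
  consider "N = 0" | "N = 1" | "N = 2" | M where "N = M + 3"
    by (metis add.commute add_2_eq_Suc' less_2_cases not_less numeral_3_eq_3 le_Suc_ex plus_1_eq_Suc
        less_Suc_eq Suc_eq_numeral numeral_2_eq_2)
  then show ?case
  proof cases
    case 4
    have "?x ^ 3 = ?x\<^sup>2 + ?x + 1"
      using sigma_root sigma_pos by (simp add: field_simps power2_eq_square power3_eq_cube)
    then have "?x ^ N = ?x ^ M * (?x\<^sup>2 + ?x + 1)"
      by (simp add: 4 power_add)
    then have "?x ^ N = ?x ^ (M + 2) + ?x ^ (M + 1) + ?x ^ M"
      by (simp add: algebra_simps power2_eq_square)
    then show ?thesis
      using less[of "M + 2"] less[of "M + 1"] less[of M] card_words_of_cost_rec[of M]
      unfolding 4 by simp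
  next
    case 3
    have "1.8\<^sup>2 \<le> ?x\<^sup>2" "?x\<^sup>2 \<le> 1.9\<^sup>2"
      using x sigma_pos by (intro power_mono; simp)+
    moreover have "(1.9::real)\<^sup>2 \<le> 4" "1.5 \<le> (1.8::real)\<^sup>2"
      by (simp_all add: power2_eq_square)
    ultimately have "1.5 \<le> ?x\<^sup>2" "?x\<^sup>2 \<le> 4"
      by linarith+
    then show ?thesis
      unfolding 3 card_words_of_cost_init by simp
  qed (use x in \<open>simp_all add: card_words_of_cost_init del: One_nat_def\<close>)
qed

lemma card_simple_words_upper: "card (simple_words i j) \<le> 2 * (1 / sigma) ^ i * (1 / sigma) ^ j"
proof -
  have "card (simple_words i j) \<le> card (words_of_cost (i + j))"
    by (rule card_mono[OF finite_words_of_cost]) (auto simp: simple_words_def words_of_cost_def cost_def)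
  then show ?thesis
    using words_of_cost_bounds[of "i + j"] by (simp add: power_add)
qed

lemma card_simple_words_lower:
  "sigma\<^sup>2 / (4 * real (Suc i)) * ((1 / sigma) ^ i)\<^sup>2 \<le> card (simple_words i i)"
proof (cases i)
  case 0
  \<comment> \<open>Joining only yields words of type at least (1,1), so the empty word is treated
    separately.\<close>
  have "sigma\<^sup>2 \<le> 1"
    using sigma_bounds sigma_pos by (simp add: power_le_one)
  then show ?thesis
    by (simp add: 0 simple_words_0)
next
  case (Suc N)
  have "((1 / sigma) ^ N / 2)\<^sup>2 \<le> (real (card (words_of_cost N)))\<^sup>2"
    using words_of_cost_bounds[of N] sigma_pos by (intro power_mono) auto
  also have "\<dots> = (\<Sum>i\<le>N. real (card (simple_words i (N - i))))\<^sup>2"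
    by (simp add: card_words_of_cost)
  also have "\<dots> \<le> (\<Sum>i\<le>N. (real (card (simple_words i (N - i))))\<^sup>2) * card {..N}"
    by (rule sum_squared_le_sum_of_squares)
  also have "\<dots> = real (\<Sum>i\<le>N. (card (simple_words i (N - i)))\<^sup>2) * Suc N"
    by simp
  also have "\<dots> \<le> real (card (simple_words i i)) * Suc N"
    unfolding Suc using card_simple_words_diag[of N]
    by (intro mult_right_mono) (simp_all only: of_nat_le_iff of_nat_0_le_iff)
  also have "\<dots> \<le> real (card (simple_words i i)) * Suc i"
    using Suc by (intro mult_left_mono) auto
  finally have "((1 / sigma) ^ N / 2)\<^sup>2 / Suc i \<le> card (simple_words i i)"
    by (simp add: pos_divide_le_eq)
  \<comment> \<open>The factor \<open>sigma\<^sup>2\<close> comes from the shift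
    \<open>i = N + 1\<close>.\<close>
  moreover have "((1 / sigma) ^ N / 2)\<^sup>2 / Suc i = sigma\<^sup>2 / (4 * real (Suc i)) * ((1 / sigma) ^ i)\<^sup>2"
    using sigma_pos by (simp add: Suc power2_eq_square field_simps)
  ultimately show ?thesis
    by simp
qed

section \<open>Comparison of \<open>u\<close> with the square of \<open>Theta\<close>\<close>

lemma u_upper: "real (u n n) \<le> 2 * (Theta n)\<^sup>2"
proof -
  let ?F = "\<lambda>i. fact i * real (Stirling n i)"
  have "real (u n n) = (\<Sum>i\<le>n. \<Sum>j\<le>n. ?F i * ?F j * card (simple_words i j))"
    by (simp add: u_eq)
  also have "\<dots> \<le> (\<Sum>i\<le>n. \<Sum>j\<le>n. ?F i * ?F j * (2 * (1 / sigma) ^ i * (1 / sigma) ^ j))"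
    by (intro sum_mono mult_left_mono card_simple_words_upper) auto
  also have "\<dots> = (\<Sum>i\<le>n. \<Sum>j\<le>n. 2 * (Psi n i * Psi n j))"
    by (simp add: Psi_eq mult_ac)
  also have "\<dots> = 2 * (Theta n)\<^sup>2"
    by (simp add: Theta_def power2_eq_square sum_product) (simp add: sum_distrib_left)
  finally show ?thesis .
qed

lemma u_lower: "(sigma / (2 * real (Suc n)))\<^sup>2 * (Theta n)\<^sup>2 \<le> real (u n n)"
proof -
  let ?F = "\<lambda>i. fact i * real (Stirling n i)" and ?c = "sigma\<^sup>2 / (4 * real (Suc n))"
  \<comment> \<open>One factor \<open>1 / Suc n\<close>, inside \<open>?c\<close>, pays for the
    diagonal count of words, the other for Cauchy-Schwarz over \<open>i\<close>.\<close>
  have "(sigma / (2 * real (Suc n)))\<^sup>2 * (Theta n)\<^sup>2 = ?c / Suc n * (\<Sum>i\<le>n. Psi n i)\<^sup>2"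
    by (simp add: Theta_def power2_eq_square field_simps)
  also have "\<dots> \<le> ?c / Suc n * ((\<Sum>i\<le>n. (Psi n i)\<^sup>2) * card {..n})"
    by (intro mult_left_mono sum_squared_le_sum_of_squares) auto
  also have "\<dots> = ?c * (\<Sum>i\<le>n. (Psi n i)\<^sup>2)"
    by simp
  also have "\<dots> = (\<Sum>i\<le>n. (?F i)\<^sup>2 * (?c * ((1 / sigma) ^ i)\<^sup>2))"
    by (simp add: sum_distrib_left Psi_eq power_mult_distrib mult_ac)
  also have "\<dots> \<le> (\<Sum>i\<le>n. (?F i)\<^sup>2 * card (simple_words i i))"
  proof (intro sum_mono mult_left_mono)
    fix i assume "i \<in> {..n}"
    then have "?c * ((1 / sigma) ^ i)\<^sup>2 \<le> sigma\<^sup>2 / (4 * real (Suc i)) * ((1 / sigma) ^ i)\<^sup>2"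
      by (intro mult_right_mono divide_left_mono) auto
    also note card_simple_words_lower
    finally show "?c * ((1 / sigma) ^ i)\<^sup>2 \<le> card (simple_words i i)" .
  qed auto
  also have "\<dots> \<le> (\<Sum>i\<le>n. \<Sum>j\<le>n. ?F i * ?F j * card (simple_words i j))"
  proof (rule sum_mono)
    fix i assume "i \<in> {..n}"
    then have "?F i * ?F i * card (simple_words i i) \<le> (\<Sum>j\<le>n. ?F i * ?F j * card (simple_words i j))"
      by (intro member_le_sum[where f = "\<lambda>j. ?F i * ?F j * card (simple_words i j)"]) auto
    then show "(?F i)\<^sup>2 * card (simple_words i i) \<le> (\<Sum>j\<le>n. ?F i * ?F j * card (simple_words i j))"
      by (simp add: power2_eq_square)
  qed
  also have "\<dots> = real (u n n)"
    by (simp add: u_eq)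
  finally show ?thesis .
qed

lemma Theta_squared: "(Theta n)\<^sup>2 = (fact n)\<^sup>2 * Z ^ (2 * n) * (scaled_Theta n)\<^sup>2"
proof -
  have "Theta n = fact n * Z ^ n * scaled_Theta n"
    using rho_bounds by (simp add: scaled_Theta_def Z_eq power_one_over)
  then show ?thesis
    by (simp add: power_mult_distrib power_mult[symmetric] mult.commute[of n])
qed

lemma scaled_Theta_squared_bounds: "1 / 4 \<le> (scaled_Theta n)\<^sup>2" "(scaled_Theta n)\<^sup>2 \<le> 1"
proof -
  have "1 / 2 \<le> (1 + (1 / 2 :: real) ^ n) / 2"
    by simp
  also have "\<dots> \<le> scaled_Theta n"
    by (rule scaled_Theta_lower)
  finally show "1 / 4 \<le> (scaled_Theta n)\<^sup>2" "(scaled_Theta n)\<^sup>2 \<le> 1"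
    using power_mono[of "1/2" "scaled_Theta n" 2] power_mono[of "scaled_Theta n" 1 2] scaled_Theta_upper[of n]
    by (simp_all add: power2_eq_square)
qed

text \<open>One natural exponent serves both inequalities; as \<open>n \<ge> 2\<close>, constant
  factors are absorbed into a larger exponent.\<close>

lemma eq_upto_polyI:
  assumes "\<And>n. n \<ge> 2 \<Longrightarrow> b n > 0"
    and "\<And>n. n \<ge> 2 \<Longrightarrow> b n / real n ^ k \<le> a n" and "\<And>n. n \<ge> 2 \<Longrightarrow> a n \<le> real n ^ k * b n"
    and "k > 0"
  shows "eq_upto_poly a b"
  unfolding eq_upto_poly_def
proof (intro exI[of _ "real k"] conjI allI impI)
  fix n :: nat assume n: "n \<ge> 2"
  then show "real n powr - real k \<le> a n / b n"
    using assms(1,2)[OF n] by (simp add: powr_minus powr_realpow field_simps)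
  show "a n / b n \<le> real n powr real k"
    using assms(1,3)[OF n] n by (simp add: powr_realpow field_simps)
qed (use assms in simp)

theorem corollary9p8:
  shows "eq_upto_poly (\<lambda>n. u_hat n n) (\<lambda>n. (fact n)\<^sup>2 * Z ^ (2 * n))
       \<and> eq_upto_poly (\<lambda>n. real (u n n)) (\<lambda>n. (fact n)\<^sup>2 * Z ^ (2 * n))
       \<and> rounds_to Z 2.30322 5
       \<and> rounds_to (Z\<^sup>2) 5.30482 5"
proof (intro conjI)
  let ?b = "\<lambda>n. (fact n)\<^sup>2 * Z ^ (2 * n)"
  have b: "?b n > 0" for n
    using Z_bounds by simp
  have pow2: "(2::real) ^ k \<le> real n ^ k" if "n \<ge> 2" for n k
    using that by (intro power_mono) auto
  have Theta: "?b n / 4 \<le> (Theta n)\<^sup>2" "(Theta n)\<^sup>2 \<le> ?b n" for n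
    using mult_left_mono[OF scaled_Theta_squared_bounds(1)[of n], of "?b n"]
      mult_left_mono[OF scaled_Theta_squared_bounds(2)[of n], of "?b n"] b[of n]
    by (simp_all add: Theta_squared)
  show "eq_upto_poly (\<lambda>n. u_hat n n) ?b"
  proof (rule eq_upto_polyI[where k = 2])
    fix n :: nat assume n: "n \<ge> 2"
    have u_hat: "u_hat n n = (Theta n)\<^sup>2"
      by (simp add: u_hat_eq power2_eq_square)
    have "?b n / real n ^ 2 \<le> ?b n / 4"
      using pow2[OF n, of 2] b[of n] n by (intro divide_left_mono) auto
    then show "?b n / real n ^ 2 \<le> u_hat n n"
      using Theta(1)[of n] unfolding u_hat by (rule order_trans)
    have "u_hat n n \<le> 1 * ?b n"
      using Theta(2)[of n] u_hat by simp
    also have "\<dots> \<le> real n ^ 2 * ?b n"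
      using pow2[OF n, of 2] b[of n] by (intro mult_right_mono) auto
    finally show "u_hat n n \<le> real n ^ 2 * ?b n" .
  qed (use b in simp_all)
  show "eq_upto_poly (\<lambda>n. real (u n n)) ?b"
  \<comment> \<open>Eight powers of \<open>n\<close> come from squaring \<open>1 / n ^ 4\<close>,
    two more absorb the factor 4.\<close>
  proof (rule eq_upto_polyI[where k = 10])
    fix n :: nat assume n: "n \<ge> 2"
    \<comment> \<open>The chain is
      \<open>2 * (n + 1) \<le> 4 * n \<le> n ^ 3 \<le> sigma * n ^ 4\<close>, the last step by
      \<open>sigma > 1/2\<close>.\<close>
    have "1 / real n ^ 4 \<le> sigma / (2 * real (Suc n))"
    proof -
      have "2 * real (Suc n) \<le> 4 * real n"
        using n by simp
      also have "\<dots> \<le> real n ^ 2 * real n"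
        using pow2[OF n, of 2] by (intro mult_right_mono) auto
      also have "\<dots> \<le> sigma * real n * (real n ^ 2 * real n)"
      proof -
        have "0.5 * 2 \<le> sigma * real n"
          using sigma_bounds n by (intro mult_mono) auto
        then show ?thesis
          using mult_right_mono[of 1 "sigma * real n" "real n ^ 2 * real n"] by simp
      qed
      also have "\<dots> = sigma * real n ^ 4"
        by (simp add: eval_nat_numeral)
      finally show ?thesis
        using n by (simp add: field_simps)
    qed
    then have "(1 / real n ^ 4)\<^sup>2 \<le> (sigma / (2 * real (Suc n)))\<^sup>2"
      by (intro power_mono) auto
    then have "(1 / real n ^ 4)\<^sup>2 * (?b n / 4) \<le> (sigma / (2 * real (Suc n)))\<^sup>2 * (Theta n)\<^sup>2"
      using Theta(1)[of n] b[of n] by (intro mult_mono) auto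
    also have "\<dots> \<le> u n n"
      by (rule u_lower)
    finally have "?b n / (real n ^ 8 * 4) \<le> u n n"
      by (simp add: power_one_over flip: power_mult)
    moreover have "?b n / real n ^ 10 \<le> ?b n / (real n ^ 8 * 4)"
    proof (rule divide_left_mono)
      have "real n ^ 8 * 4 \<le> real n ^ 8 * real n ^ 2"
        using pow2[OF n, of 2] by (intro mult_left_mono) auto
      then show "real n ^ 8 * 4 \<le> real n ^ 10"
        by (simp flip: power_add)
    qed (use b[of n] n in auto)
    ultimately show "?b n / real n ^ 10 \<le> u n n"
      by linarith
    have "real (u n n) \<le> 2 * ?b n"
      using u_upper[of n] Theta(2)[of n] by linarith
    also have "\<dots> \<le> real n ^ 10 * ?b n"
      using pow2[OF n, of 10] b[of n] by (intro mult_right_mono) auto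
    finally show "real (u n n) \<le> real n ^ 10 * ?b n" .
  qed (use b in simp_all)
qed (rule rounds_to_Z rounds_to_Z_squared)+

end
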